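(* Let $K$ be a number field and $a,b\in K$. Then the following are equivalent: (i) $a$ is a norm for $K(\sqrt[3]{b})/K$; (ii) $b$ is a norm for $K(\sqrt[3]{a})/K$; (iii) $a^2b$ is a norm for $K(\sqrt[3]{a+b})/K$; (iv) $a^2b$ is a norm for $K(\sqrt[3]{a-b})/K$; (v) $V_{a,b}(K)\neq\emptyset$, where $V_{a,b}=\{x_1^3+ax_2^3+bx_3^3+abx_4^3=0\}\subset\mathbb{P}^3$.
   Context: For $d\in K$, $K(\sqrt[3]{d})$ denotes $K$ adjoined a cube root of $d$ (equal to $K$ when $d$ is a cube in $K$), and "$c$ is a norm for $K(\sqrt[3]{d})/K$" means $c=N_{K(\sqrt[3]{d})/K}(\xi)$ for some $\xi\in K(\sqrt[3]{d})$. *)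

theory Defs
  imports
    "HOL-Algebra.Generated_Fields"
    "HOL-Algebra.Algebraic_Closure_Type"
    "Jordan_Normal_Form.Determinant"
begin

text \<open>
  A number field is a type of sort \<^class>\<open>field_char_0\<close> that is finite-dimensional over the
  rationals. The type variable of a theorem is universally quantified.
\<close>

definition number_field :: "'a::field_char_0 itself \<Rightarrow> bool" where
  "number_field _ \<longleftrightarrow>
     (\<exists>B. finite_dimensional_vector_space (\<lambda>(q::rat) (x::'a). of_rat q * x) B)"

text \<open>
  Extensions of \<open>K = 'a\<close> are realised as subsets of its algebraic closure, which is a
  \<open>K\<close>-vector space via the embedding \<^const>\<open>to_ac\<close>.
\<close>

interpretation ac: vector_space "\<lambda>(k::'a::field) (x::'a alg_closure). to_ac k * x"
  by unfold_locales (simp_all add: algebra_simps)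

definition adjoin :: "'a::field alg_closure \<Rightarrow> 'a alg_closure set" where
  "adjoin \<theta> = generate_field ring_of_type_algebra (insert \<theta> (range to_ac))"

text \<open>
  If \<open>d\<close> is a cube in \<open>K\<close>, the cube root is taken in \<open>K\<close>, so that adjoining it yields \<open>K\<close> even
  when \<open>K\<close> lacks the primitive cube roots of unity. Otherwise all cube roots of \<open>d\<close> are conjugate
  over \<open>K\<close>, so the choice affects \<open>adjoin_cbrt d\<close> only up to \<open>K\<close>-isomorphism.
\<close>

definition cbrt_ac :: "'a::field \<Rightarrow> 'a alg_closure" where
  "cbrt_ac d = (if \<exists>c. c ^ 3 = d then to_ac (SOME c. c ^ 3 = d) else (SOME \<theta>. \<theta> ^ 3 = to_ac d))"

definition adjoin_cbrt :: "'a::field \<Rightarrow> 'a alg_closure set" where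
  "adjoin_cbrt d = adjoin (cbrt_ac d)"

definition is_basis_of :: "'a::field alg_closure set \<Rightarrow> 'a alg_closure list \<Rightarrow> bool" where
  "is_basis_of L bs \<longleftrightarrow> distinct bs \<and> ac.independent (set bs) \<and> ac.span (set bs) = L"

text \<open>
  The matrix over \<open>K\<close> of multiplication by \<open>\<xi>\<close>: its \<open>j\<close>-th column holds the coordinates of
  \<open>\<xi> * bs ! j\<close>.
\<close>

definition mult_matrix :: "'a::field alg_closure list \<Rightarrow> 'a alg_closure \<Rightarrow> 'a mat" where
  "mult_matrix bs \<xi> =
     mat (length bs) (length bs) (\<lambda>(i, j). ac.representation (set bs) (\<xi> * bs ! j) (bs ! i))"

text \<open>
  The norm \<open>N\<^bsub>L/K\<^esub>(\<xi>)\<close> for \<open>\<xi> \<in> L\<close> and \<open>L/K\<close> finite; by basis independence of the determinant it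
  does not depend on the chosen basis. For other arguments the value is meaningless.
\<close>

definition field_norm :: "'a::field alg_closure set \<Rightarrow> 'a alg_closure \<Rightarrow> 'a" where
  "field_norm L \<xi> = det (mult_matrix (SOME bs. is_basis_of L bs) \<xi>)"

definition is_norm_for :: "'a::field \<Rightarrow> 'a alg_closure set \<Rightarrow> bool" where
  "is_norm_for c L \<longleftrightarrow> (\<exists>\<xi>\<in>L. c = field_norm L \<xi>)"

definition proportional :: "(('a::field \<times> 'a \<times> 'a \<times> 'a) \<times> ('a \<times> 'a \<times> 'a \<times> 'a)) set" where
  "proportional = {((x1, x2, x3, x4), (y1, y2, y3, y4)).
     \<exists>c. c \<noteq> 0 \<and> y1 = c * x1 \<and> y2 = c * x2 \<and> y3 = c * x3 \<and> y4 = c * x4}"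

definition proj_space3 :: "('a::field \<times> 'a \<times> 'a \<times> 'a) set set" where
  "proj_space3 = (UNIV - {(0, 0, 0, 0)}) // proportional"

definition V :: "'a::field \<Rightarrow> 'a \<Rightarrow> ('a \<times> 'a \<times> 'a \<times> 'a) set set" where
  "V a b = {P \<in> proj_space3. \<forall>(x1, x2, x3, x4) \<in> P.
     x1 ^ 3 + a * x2 ^ 3 + b * x3 ^ 3 + a * b * x4 ^ 3 = 0}"

end

(* Call c represented by d if c is a value of x^3 + d y^3 + d^2 z^3 - 3 d x y z, which for non-cubes d
   is the norm form of K(cbrt d)/K. The numbers represented by d are closed under products and
   inverses, and contain the cubes, d and 1 + d. For nonzero a, b, representing a by b amounts to
   writing -a as a quotient of values of x^3 + b y^3, that is, to a point on V_{a,b}, whose equation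
   is symmetric in a and b. Multiplying by suitable represented numbers and swapping, with u = b / a,
     (a, b) ~ (b, a) ~ (u, a) ~ (a, u) ~ ((1 + u) a, u) = (a + b, u) ~ (u, a + b) ~ (a^2 b, a + b),
   and since -1 is a cube, b may be replaced by -b. *)
theory Submission
  imports Defs
begin

subsection \<open>The cubic norm form\<close>

text \<open>The determinant of multiplication by \<open>x + y t + z t^2\<close> on
  \<open>K[t]/(t^3 - d)\<close>, so it makes sense for cubes \<open>d\<close> as well.\<close>

definition cbrt_form :: "'a::field \<Rightarrow> 'a \<Rightarrow> 'a \<Rightarrow> 'a \<Rightarrow> 'a" where
  "cbrt_form d x y z = x ^ 3 + d * y ^ 3 + d ^ 2 * z ^ 3 - 3 * d * x * y * z"

definition is_cbrt_norm :: "'a::field \<Rightarrow> 'a \<Rightarrow> bool" where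
  "is_cbrt_norm c d \<longleftrightarrow> (\<exists>x y z. c = cbrt_form d x y z)"

lemma is_cbrt_normI: "c = cbrt_form d x y z \<Longrightarrow> is_cbrt_norm c d"
  unfolding is_cbrt_norm_def by blast

text \<open>The arguments on the right are the coefficients of the product of the two elements,
  reduced by \<open>t^3 = d\<close>.\<close>

lemma cbrt_form_mult:
  fixes d :: "'a::field"
  shows "cbrt_form d x y z * cbrt_form d x' y' z' =
     cbrt_form d (x * x' + d * (y * z' + z * y')) (x * y' + y * x' + d * (z * z'))
       (x * z' + y * y' + z * x')"
  unfolding cbrt_form_def by (simp add: power2_eq_square power3_eq_cube algebra_simps)

text \<open>The arguments belong to the adjugate, the cofactor that multiplies
  \<open>x + y t + z t^2\<close> to its norm \<open>N\<close>; its own norm is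
  \<open>N^3 / N\<close>.\<close>

lemma cbrt_form_adjugate:
  fixes d :: "'a::field"
  shows "cbrt_form d (x\<^sup>2 - d * y * z) (d * z\<^sup>2 - x * y) (y\<^sup>2 - x * z) = (cbrt_form d x y z)\<^sup>2"
  unfolding cbrt_form_def by (simp add: power2_eq_square power3_eq_cube algebra_simps)

lemma is_cbrt_norm_cube: "is_cbrt_norm (t ^ 3) d"
  by (rule is_cbrt_normI[of _ _ t 0 0]) (simp add: cbrt_form_def)

lemma is_cbrt_norm_mult:
  assumes "is_cbrt_norm c d" "is_cbrt_norm c' d"
  shows "is_cbrt_norm (c * c') d"
  using assms cbrt_form_mult unfolding is_cbrt_norm_def by metis

text \<open>The adjugate represents \<open>c^2\<close>, which differs from \<open>1 / c\<close> by a
  cube.\<close>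

lemma is_cbrt_norm_inverse:
  fixes c d :: "'a::field"
  assumes "is_cbrt_norm c d"
  shows "is_cbrt_norm (inverse c) d"
proof (cases "c = 0")
  case True
  with assms show ?thesis by simp
next
  case False
  obtain x y z where c: "c = cbrt_form d x y z"
    using assms unfolding is_cbrt_norm_def by blast
  have "is_cbrt_norm (c ^ 2) d"
    unfolding c by (rule is_cbrt_normI[OF cbrt_form_adjugate[symmetric]])
  then have "is_cbrt_norm (c ^ 2 * (inverse c) ^ 3) d"
    using is_cbrt_norm_mult is_cbrt_norm_cube by blast
  also have "c ^ 2 * (inverse c) ^ 3 = inverse c"
    using False by (simp add: field_simps power2_eq_square power3_eq_cube)
  finally show ?thesis .
qed

lemma is_cbrt_norm_mult_iff:
  fixes c d u :: "'a::field"
  assumes "is_cbrt_norm u d" "u \<noteq> 0"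
  shows "is_cbrt_norm (u * c) d \<longleftrightarrow> is_cbrt_norm c d"
proof
  assume "is_cbrt_norm (u * c) d"
  then have "is_cbrt_norm (inverse u * (u * c)) d"
    using assms is_cbrt_norm_mult is_cbrt_norm_inverse by blast
  then show "is_cbrt_norm c d"
    using \<open>u \<noteq> 0\<close> by (simp flip: mult.assoc)
qed (use assms is_cbrt_norm_mult in blast)

lemma is_cbrt_norm_self: "is_cbrt_norm d d"
  by (rule is_cbrt_normI[of _ _ 0 1 0]) (simp add: cbrt_form_def)

lemma is_cbrt_norm_one_plus: "is_cbrt_norm (1 + d) d"
  by (rule is_cbrt_normI[of _ _ 1 1 0]) (simp add: cbrt_form_def)

text \<open>If \<open>d = e\<^sup>3\<close>, then \<open>K[t]/(t\<^sup>3 - d)\<close> splits off a factor \<open>K\<close>; the coefficients are those of the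
  element that is \<open>c\<close> in this factor and \<open>1\<close> in the complementary one.\<close>

lemma is_cbrt_norm_of_cube:
  fixes c d e :: "'a::field_char_0"
  assumes "e ^ 3 = d" "d \<noteq> 0"
  shows "is_cbrt_norm c d"
proof (rule is_cbrt_normI)
  have e: "e \<noteq> 0"
    using assms by auto
  \<comment> \<open>The idempotent of the factor \<open>t = e\<close> is
    \<open>(1 + t/e + t^2/e^2) / 3\<close>; the element sought is 1 plus \<open>c - 1\<close> times
    it.\<close>
  define s where "s = (c - 1) / 3"
  have c: "c = 1 + 3 * s"
    by (simp add: s_def field_simps)
  have "d * (s / e) ^ 3 = s ^ 3" "d\<^sup>2 * (s / e\<^sup>2) ^ 3 = s ^ 3"
    "3 * d * (1 + s) * (s / e) * (s / e\<^sup>2) = 3 * (1 + s) * s\<^sup>2"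
    unfolding assms(1)[symmetric] using e
    by (simp_all add: field_simps power2_eq_square power3_eq_cube)
  then have "cbrt_form d (1 + s) (s / e) (s / e\<^sup>2) = (1 + s) ^ 3 + s ^ 3 + s ^ 3 - 3 * (1 + s) * s\<^sup>2"
    unfolding cbrt_form_def by simp
  also have "\<dots> = c"
    unfolding c by (simp add: power2_eq_square power3_eq_cube algebra_simps)
  finally show "c = cbrt_form d (1 + s) (s / e) (s / e\<^sup>2)" ..
qed

subsection \<open>Rational points on the cubic surface\<close>

definition has_surface_point :: "'a::field \<Rightarrow> 'a \<Rightarrow> bool" where
  "has_surface_point a b \<longleftrightarrow> (\<exists>x1 x2 x3 x4. (x1, x2, x3, x4) \<noteq> (0, 0, 0, 0) \<and>
     x1 ^ 3 + a * x2 ^ 3 + b * x3 ^ 3 + a * b * x4 ^ 3 = 0)"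

lemma has_surface_pointI:
  "\<lbrakk>x1 ^ 3 + a * x2 ^ 3 + b * x3 ^ 3 + a * b * x4 ^ 3 = 0;
     (x1, x2, x3, x4) \<noteq> (0, 0, 0, 0)\<rbrakk> \<Longrightarrow> has_surface_point a b"
  unfolding has_surface_point_def by blast

lemma has_surface_point_commute:
  fixes a b :: "'a::field"
  shows "has_surface_point a b \<longleftrightarrow> has_surface_point b a"
proof -
  have "has_surface_point b a" if point: "has_surface_point a b" for a b :: 'a
  proof -
    obtain x1 x2 x3 x4 where
      "x1 ^ 3 + a * x2 ^ 3 + b * x3 ^ 3 + a * b * x4 ^ 3 = 0" "(x1, x2, x3, x4) \<noteq> (0, 0, 0, 0)"
      using point unfolding has_surface_point_def by blast
    then show ?thesis
      by (intro has_surface_pointI[of x1 b x3 a x2 x4]) (auto simp: algebra_simps)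
  qed
  then show ?thesis by blast
qed

text \<open>The surface equation reads \<open>a (x2^3 + b x4^3) = -(x1^3 + b x3^3)\<close>, and both
  binary forms are norms of elements without a \<open>\<theta>^2\<close>-term. One direction clears
  that term, the other divides.\<close>

lemma is_cbrt_norm_iff_surface:
  fixes a b :: "'a::field_char_0"
  assumes "a \<noteq> 0" "b \<noteq> 0"
  shows "is_cbrt_norm a b \<longleftrightarrow> has_surface_point a b"
proof
  assume "is_cbrt_norm a b"
  then obtain x y z where a: "a = cbrt_form b x y z"
    unfolding is_cbrt_norm_def by blast
  text \<open>Some nonzero multiple of \<open>x + y \<theta> + z \<theta>\<^sup>2\<close> by an element \<open>s + t \<theta>\<close> has no \<open>\<theta>\<^sup>2\<close>-term.\<close>
  obtain s t where st: "(s, t) \<noteq> (0, 0)" "y * t + z * s = 0"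
  proof (cases "(y, z) = (0, 0)")
    case True
    then show ?thesis using that[of 1 0] by simp
  next
    case False
    then show ?thesis using that[of y "- z"] by simp
  qed
  \<comment> \<open>The two surviving coefficients of the product with
    \<open>s + t \<theta>\<close>.\<close>
  define u w where "u = x * s + b * z * t" and "w = x * t + y * s"
  have "a * (s ^ 3 + b * t ^ 3) = cbrt_form b x y z * cbrt_form b s t 0"
    unfolding a by (simp add: cbrt_form_def)
  also have "\<dots> = cbrt_form b u w 0"
    unfolding u_def w_def cbrt_form_mult using st(2) by (simp add: algebra_simps)
  also have "\<dots> = u ^ 3 + b * w ^ 3"
    by (simp add: cbrt_form_def)
  finally show "has_surface_point a b"
    using st(1)
    by (intro has_surface_pointI[of "- u" _ s _ "- w" t])
      (auto simp: algebra_simps)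
next
  assume "has_surface_point a b"
  then obtain x1 x2 x3 x4 where
    eq: "x1 ^ 3 + a * x2 ^ 3 + b * x3 ^ 3 + a * b * x4 ^ 3 = 0" and
    nz: "(x1, x2, x3, x4) \<noteq> (0, 0, 0, 0)"
    unfolding has_surface_point_def by blast
  show "is_cbrt_norm a b"
  proof (cases "\<exists>e. e ^ 3 = b")
    \<comment> \<open>For a cube \<open>b\<close> the form \<open>x^3 + b y^3\<close> has nontrivial
      zeros and the division below could fail, but then every number is represented.\<close>
    case True
    then show ?thesis using is_cbrt_norm_of_cube assms by blast
  next
    case False
    have anisotropic: "x = 0 \<and> y = 0" if "x ^ 3 + b * y ^ 3 = 0" for x y
    proof (cases "y = 0")
      case False
      moreover have "(- x) ^ 3 = b * y ^ 3"
        using that by (simp add: neg_eq_iff_add_eq_0)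
      ultimately have "(- x / y) ^ 3 = b"
        by (simp only: power_divide) simp
      with \<open>\<nexists>e. e ^ 3 = b\<close> show ?thesis by blast
    qed (use that in simp)
    define N where "N = x2 ^ 3 + b * x4 ^ 3"
    have eq': "a * N = (- x1) ^ 3 + b * (- x3) ^ 3"
      using eq unfolding N_def by (simp add: algebra_simps eq_neg_iff_add_eq_0)
    \<comment> \<open>If \<open>N = 0\<close>, anisotropy kills \<open>x2\<close> and
      \<open>x4\<close>, and then by \<open>eq'\<close> also \<open>x1\<close> and
      \<open>x3\<close>.\<close>
    have "N \<noteq> 0"
      using anisotropic[of x2 x4] anisotropic[of "- x1" "- x3"] nz eq' by (auto simp: N_def)
    have "is_cbrt_norm (N * a) b"
      by (rule is_cbrt_normI[of _ _ "- x1" "- x3" 0]) (use eq' in \<open>simp add: cbrt_form_def mult.commute\<close>)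
    moreover have "is_cbrt_norm N b"
      by (rule is_cbrt_normI[of _ _ x2 x4 0]) (simp add: cbrt_form_def N_def)
    ultimately show ?thesis
      using is_cbrt_norm_mult_iff \<open>N \<noteq> 0\<close> by blast
  qed
qed

lemma is_cbrt_norm_commute:
  fixes a b :: "'a::field_char_0"
  assumes "a \<noteq> 0" "b \<noteq> 0"
  shows "is_cbrt_norm a b \<longleftrightarrow> is_cbrt_norm b a"
  using assms is_cbrt_norm_iff_surface has_surface_point_commute by blast

lemma is_cbrt_norm_add_iff:
  fixes a b :: "'a::field_char_0"
  assumes "a \<noteq> 0" "b \<noteq> 0" "a + b \<noteq> 0"
  shows "is_cbrt_norm (a\<^sup>2 * b) (a + b) \<longleftrightarrow> is_cbrt_norm a b"
proof -
  \<comment> \<open>Cancelling \<open>a\<close> from \<open>b\<close> leaves \<open>u\<close>, and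
    \<open>a + b\<close> is \<open>a\<close> times \<open>1 + u\<close>, a number represented by
    \<open>u\<close>.\<close>
  define u where "u = b / a"
  have u: "u \<noteq> 0" "a * u = b" "(1 + u) * a = a + b" "1 + u \<noteq> 0"
    using assms by (auto simp: u_def field_simps)
  have cube: "a ^ 3 * u = a\<^sup>2 * b"
    using u(2) by (simp add: power2_eq_square power3_eq_cube mult.assoc)
  have "is_cbrt_norm a b \<longleftrightarrow> is_cbrt_norm b a"
    using assms is_cbrt_norm_commute by blast
  also have "\<dots> \<longleftrightarrow> is_cbrt_norm u a"
    using is_cbrt_norm_mult_iff[OF is_cbrt_norm_self[of a] assms(1), of u] u(2) by simp
  also have "\<dots> \<longleftrightarrow> is_cbrt_norm a u"
    using assms u is_cbrt_norm_commute by blast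
  also have "\<dots> \<longleftrightarrow> is_cbrt_norm (a + b) u"
    using is_cbrt_norm_mult_iff[OF is_cbrt_norm_one_plus u(4), of a] u(3) by simp
  also have "\<dots> \<longleftrightarrow> is_cbrt_norm u (a + b)"
    using assms u is_cbrt_norm_commute by blast
  also have "\<dots> \<longleftrightarrow> is_cbrt_norm (a\<^sup>2 * b) (a + b)"
    using is_cbrt_norm_mult_iff[OF is_cbrt_norm_cube[of a "a + b"], of u] assms(1) by (simp add: cube)
  finally show ?thesis ..
qed

lemma is_cbrt_norm_minus_iff: "is_cbrt_norm (- c) d \<longleftrightarrow> is_cbrt_norm c d"
  for c d :: "'a::field"
  using is_cbrt_norm_mult_iff[OF is_cbrt_norm_cube[of "- 1" d], of c] by simp

text \<open>The equation is homogeneous of degree 3, so it holds on a whole class once it holds at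
  one representative.\<close>

lemma V_nonempty_iff: "V a b \<noteq> {} \<longleftrightarrow> has_surface_point a b"
  for a b :: "'a::field"
proof
  assume "V a b \<noteq> {}"
  then obtain P where "P \<in> V a b" by blast
  then obtain x1 x2 x3 x4 where P: "P = proportional `` {(x1, x2, x3, x4)}"
    and nz: "(x1, x2, x3, x4) \<noteq> (0, 0, 0, 0)"
    and eq: "\<forall>(x1, x2, x3, x4) \<in> P. x1 ^ 3 + a * x2 ^ 3 + b * x3 ^ 3 + a * b * x4 ^ 3 = 0"
    unfolding V_def proj_space3_def quotient_def by auto
  have "(x1, x2, x3, x4) \<in> P"
    unfolding P proportional_def by (auto intro!: exI[of _ 1])
  then show "has_surface_point a b"
    using eq nz by (intro has_surface_pointI) auto
next
  assume "has_surface_point a b"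
  then obtain x1 x2 x3 x4 where
    eq: "x1 ^ 3 + a * x2 ^ 3 + b * x3 ^ 3 + a * b * x4 ^ 3 = 0" and
    nz: "(x1, x2, x3, x4) \<noteq> (0, 0, 0, 0)"
    unfolding has_surface_point_def by blast
  have scale: "(c * x1) ^ 3 + a * (c * x2) ^ 3 + b * (c * x3) ^ 3 + a * b * (c * x4) ^ 3 = 0" for c
    using arg_cong[OF eq, of "\<lambda>v. c ^ 3 * v"] by (simp add: power_mult_distrib algebra_simps)
  have "proportional `` {(x1, x2, x3, x4)} \<in> proj_space3"
    using nz unfolding proj_space3_def by (intro quotientI) auto
  then have "proportional `` {(x1, x2, x3, x4)} \<in> V a b"
    using scale unfolding V_def by (auto simp: proportional_def)
  then show "V a b \<noteq> {}" by blast
qed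

subsection \<open>Basis independence of the field norm\<close>

abbreviation coords :: "'a::field alg_closure list \<Rightarrow> 'a alg_closure \<Rightarrow> nat \<Rightarrow> 'a" where
  "coords bs x i \<equiv> ac.representation (set bs) x (bs ! i)"

lemma sum_coords:
  assumes "is_basis_of L bs" "x \<in> L"
  shows "(\<Sum>i<length bs. to_ac (coords bs x i) * bs ! i) = x"
proof -
  have "(\<Sum>i<length bs. to_ac (coords bs x i) * bs ! i)
      = (\<Sum>b\<in>set bs. to_ac (ac.representation (set bs) x b) * b)"
    using assms(1) unfolding is_basis_of_def
    by (intro sum.reindex_bij_betw bij_betw_nth) auto
  also have "\<dots> = x"
    using assms unfolding is_basis_of_def by (intro ac.sum_representation_eq) auto
  finally show ?thesis .
qed

lemma representation_lincomb:
  assumes "ac.independent B" "\<And>k. k \<in> I \<Longrightarrow> v k \<in> ac.span B"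
  shows "ac.representation B (\<Sum>k\<in>I. to_ac (g k) * v k) b
       = (\<Sum>k\<in>I. g k * ac.representation B (v k) b)"
  using assms by (simp add: ac.representation_sum ac.representation_scale ac.span_scale)

lemma length_basis_eq:
  assumes "is_basis_of L bs" "is_basis_of L cs"
  shows "length bs = length cs"
  using assms ac.dim_eq_card unfolding is_basis_of_def by (metis distinct_card)

text \<open>It turns \<open>cs\<close>-coordinates into \<open>bs\<close>-coordinates.\<close>

definition change_matrix :: "'a::field alg_closure list \<Rightarrow> 'a alg_closure list \<Rightarrow> 'a mat" where
  "change_matrix bs cs = mat (length bs) (length cs) (\<lambda>(i, j). coords bs (cs ! j) i)"

lemma basis_nth_mem:
  assumes "is_basis_of L bs" "i < length bs"
  shows "bs ! i \<in> L"
  using assms ac.span_base unfolding is_basis_of_def by (metis nth_mem)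

text \<open>Column \<open>j\<close> expands \<open>bs ! j\<close> in \<open>cs\<close> and the
  result again in \<open>bs\<close>, which returns a unit vector.\<close>

lemma change_matrix_inverse:
  assumes bs: "is_basis_of L bs" and cs: "is_basis_of L cs"
  shows "change_matrix bs cs * change_matrix cs bs = 1\<^sub>m (length bs)"
proof (rule eq_matI)
  fix i j assume ij: "i < dim_row (1\<^sub>m (length bs) :: 'a mat)" "j < dim_col (1\<^sub>m (length bs) :: 'a mat)"
  have "(\<Sum>k<length cs. coords cs (bs ! j) k * coords bs (cs ! k) i)
      = coords bs (\<Sum>k<length cs. to_ac (coords cs (bs ! j) k) * cs ! k) i"
    using bs basis_nth_mem[OF cs] unfolding is_basis_of_def
    by (intro representation_lincomb[symmetric]) auto
  also have "\<dots> = coords bs (bs ! j) i"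
    using sum_coords[OF cs] basis_nth_mem[OF bs] ij by simp
  also have "\<dots> = (if i = j then 1 else 0)"
    using bs ij unfolding is_basis_of_def
    by (auto simp: ac.representation_basis nth_eq_iff_index_eq)
  finally show "(change_matrix bs cs * change_matrix cs bs) $$ (i, j) = 1\<^sub>m (length bs) $$ (i, j)"
    using ij by (simp add: change_matrix_def scalar_prod_def mult.commute lessThan_atLeast0)
qed (simp_all add: change_matrix_def)

text \<open>Both sides describe multiplication by \<open>\<xi>\<close> with input in
  \<open>cs\<close>-coordinates and output in \<open>bs\<close>-coordinates:
  \<open>\<xi> * cs ! j\<close> is expanded in two ways.\<close>

lemma mult_matrix_change_basis:
  assumes bs: "is_basis_of L bs" and cs: "is_basis_of L cs"
    and closed: "\<And>x. x \<in> L \<Longrightarrow> \<xi> * x \<in> L"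
  shows "mult_matrix bs \<xi> * change_matrix bs cs = change_matrix bs cs * mult_matrix cs \<xi>"
proof (rule eq_matI)
  fix i j
  assume ij: "i < dim_row (change_matrix bs cs * mult_matrix cs \<xi>)"
    "j < dim_col (change_matrix bs cs * mult_matrix cs \<xi>)"
  then have ij: "i < length bs" "j < length cs"
    by (simp_all add: change_matrix_def mult_matrix_def)
  have "(\<Sum>k<length bs. coords bs (cs ! j) k * coords bs (\<xi> * bs ! k) i)
      = coords bs (\<Sum>k<length bs. to_ac (coords bs (cs ! j) k) * (\<xi> * bs ! k)) i"
    using bs closed basis_nth_mem[OF bs] unfolding is_basis_of_def
    by (intro representation_lincomb[symmetric]) auto
  also have "(\<Sum>k<length bs. to_ac (coords bs (cs ! j) k) * (\<xi> * bs ! k)) = \<xi> * cs ! j"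
    using arg_cong[OF sum_coords[OF bs basis_nth_mem[OF cs ij(2)]], of "\<lambda>v. \<xi> * v"]
    by (simp add: sum_distrib_left mult.left_commute)
  also have "\<dots> = (\<Sum>k<length cs. to_ac (coords cs (\<xi> * cs ! j) k) * cs ! k)"
    using sum_coords[OF cs] closed basis_nth_mem[OF cs ij(2)] by simp
  also have "coords bs \<dots> i = (\<Sum>k<length cs. coords cs (\<xi> * cs ! j) k * coords bs (cs ! k) i)"
    using bs basis_nth_mem[OF cs] unfolding is_basis_of_def
    by (intro representation_lincomb) auto
  finally show "(mult_matrix bs \<xi> * change_matrix bs cs) $$ (i, j)
      = (change_matrix bs cs * mult_matrix cs \<xi>) $$ (i, j)"
    using ij
    by (simp add: change_matrix_def mult_matrix_def scalar_prod_def mult.commute lessThan_atLeast0)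
qed (simp_all add: change_matrix_def mult_matrix_def)

text \<open>The two matrices are intertwined by a change of basis whose determinant is a unit, so
  that determinant cancels.\<close>

lemma det_mult_matrix_eq:
  assumes bs: "is_basis_of L bs" and cs: "is_basis_of L cs"
    and closed: "\<And>x. x \<in> L \<Longrightarrow> \<xi> * x \<in> L"
  shows "det (mult_matrix bs \<xi>) = det (mult_matrix cs \<xi>)"
proof -
  let ?n = "length bs"
  let ?P = "change_matrix bs cs" and ?Q = "change_matrix cs bs"
  have len: "length cs = ?n"
    using length_basis_eq[OF cs bs] .
  have carrier: "?P \<in> carrier_mat ?n ?n" "?Q \<in> carrier_mat ?n ?n"
    "mult_matrix bs \<xi> \<in> carrier_mat ?n ?n" "mult_matrix cs \<xi> \<in> carrier_mat ?n ?n"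
    by (simp_all add: change_matrix_def mult_matrix_def len)
  have "det ?P * det ?Q = 1"
    using change_matrix_inverse[OF bs cs] det_mult[OF carrier(1,2)] by simp
  then have "det ?P \<noteq> 0" by auto
  moreover have "det (mult_matrix bs \<xi>) * det ?P = det ?P * det (mult_matrix cs \<xi>)"
    using mult_matrix_change_basis[OF bs cs closed] det_mult carrier by metis
  ultimately show ?thesis by simp
qed

text \<open>Replaces the basis picked by choice with any convenient one.\<close>

lemma field_norm_eq_det:
  assumes "is_basis_of L bs" "\<And>x. x \<in> L \<Longrightarrow> \<xi> * x \<in> L"
  shows "field_norm L \<xi> = det (mult_matrix bs \<xi>)"
proof -
  have "is_basis_of L (SOME bs. is_basis_of L bs)"
    using assms(1) by (rule someI)
  then show ?thesis
    unfolding field_norm_def using assms det_mult_matrix_eq by blast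
qed

subsection \<open>Norms from pure cubic extensions\<close>

text \<open>Induction over the generated field, with the record operations translated into those of
  the type.\<close>

lemma adjoin_subset:
  fixes \<theta> :: "'a::field alg_closure"
  assumes "\<theta> \<in> S" "range to_ac \<subseteq> S"
    and add: "\<And>x y. x \<in> S \<Longrightarrow> y \<in> S \<Longrightarrow> x + y \<in> S"
    and mult: "\<And>x y. x \<in> S \<Longrightarrow> y \<in> S \<Longrightarrow> x * y \<in> S"
    and inv: "\<And>x. x \<in> S \<Longrightarrow> inverse x \<in> S"
  shows "adjoin \<theta> \<subseteq> S"
proof
  let ?R = "ring_of_type_algebra :: 'a alg_closure ring"
  interpret R: field ?R by (rule field_from_type_algebra)
  have R: "carrier ?R = UNIV" "\<one>\<^bsub>?R\<^esub> = 1" "\<zero>\<^bsub>?R\<^esub> = 0"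
    "x \<otimes>\<^bsub>?R\<^esub> y = x * y" "x \<oplus>\<^bsub>?R\<^esub> y = x + y" for x y
    by (simp_all add: ring_of_type_algebra_def)
  fix x assume "x \<in> adjoin \<theta>"
  then show "x \<in> S"
    unfolding adjoin_def
  proof (induction rule: generate_field.induct)
    case one
    have "to_ac 1 \<in> S" using assms(2) by blast
    then show ?case by (simp add: R)
  next
    case (a_inv h)
    have "\<ominus>\<^bsub>?R\<^esub> h = - h"
      by (rule R.minus_equality) (simp_all add: R)
    \<comment> \<open>A negative is a product with -1, which comes from the base field.\<close>
    moreover have "to_ac (- 1) * h \<in> S"
      using assms(2) a_inv mult by blast
    ultimately show ?case by simp
  next
    case (m_inv h)
    have "inv\<^bsub>?R\<^esub> h = inverse h"
      using m_inv by (intro R.comm_inv_char) (simp_all add: R)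
    then show ?case using m_inv inv by simp
  qed (use assms R in auto)
qed

lemma adjoin_closed:
  shows to_ac_in_adjoin: "to_ac c \<in> adjoin \<theta>"
    and self_in_adjoin: "\<theta> \<in> adjoin \<theta>"
    and add_in_adjoin: "u \<in> adjoin \<theta> \<Longrightarrow> v \<in> adjoin \<theta> \<Longrightarrow> u + v \<in> adjoin \<theta>"
    and mult_in_adjoin: "u \<in> adjoin \<theta> \<Longrightarrow> v \<in> adjoin \<theta> \<Longrightarrow> u * v \<in> adjoin \<theta>"
  using generate_field.eng_add[of u ring_of_type_algebra _ v]
    generate_field.eng_mult[of u ring_of_type_algebra _ v]
  unfolding adjoin_def by (auto simp: ring_of_type_algebra_def intro: generate_field.incl)

text \<open>This handles cubes \<open>d\<close>: the chosen root lies in the base field, so the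
  extension is trivial.\<close>

lemma adjoin_to_ac: "adjoin (to_ac c) = range to_ac"
proof
  show "adjoin (to_ac c) \<subseteq> range to_ac"
    by (intro adjoin_subset) (auto simp flip: to_ac_add to_ac_mult to_ac_inverse)
  show "range to_ac \<subseteq> adjoin (to_ac c)"
    using to_ac_in_adjoin by blast
qed

text \<open>In the basis \<open>[1]\<close> multiplication by \<open>c\<close> is the 1 x 1 matrix
  with entry \<open>c\<close>.\<close>

lemma field_norm_base: "field_norm (range to_ac) (to_ac c) = c"
proof -
  have span: "ac.span {1} = (range to_ac :: 'a alg_closure set)"
    by (auto simp: ac.span_singleton)
  have indep: "ac.independent {1 :: 'a alg_closure}"
    by simp
  have basis: "is_basis_of (range to_ac) [1 :: 'a alg_closure]"
    using span indep by (simp add: is_basis_of_def)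
  have "ac.representation {1} (to_ac c * 1) 1 = c"
    using indep ac.span_base[of 1 "{1}"]
    by (subst ac.representation_scale) (auto simp: ac.representation_basis)
  then have "mult_matrix [1] (to_ac c) = mat 1 1 (\<lambda>_. c)"
    by (auto simp: mult_matrix_def)
  then have "det (mult_matrix [1] (to_ac c)) = c"
    by (simp add: det_single)
  moreover have "to_ac c * x \<in> range to_ac" if "x \<in> range to_ac" for x
    using that by (auto simp flip: to_ac_mult)
  ultimately show ?thesis
    using field_norm_eq_det[OF basis, of "to_ac c"] by simp
qed

section \<open>Determinants of size 2 and 3\<close>

lemma det_2x2:
  fixes A :: "'a::comm_ring_1 mat"
  assumes A: "A \<in> carrier_mat 2 2"
  shows "det A = A $$ (0, 0) * A $$ (1, 1) - A $$ (0, 1) * A $$ (1, 0)"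
proof -
  have dims: "dim_row A = 2" "dim_col A = 2"
    using A by auto
  have "det (mat_delete A 0 j) = mat_delete A 0 j $$ (0, 0)" for j
    by (rule det_single, rule carrier_matI) (simp_all add: mat_delete_def dims)
  moreover have "det A = (\<Sum>j<2. A $$ (0, j) * ((- 1) ^ j * det (mat_delete A 0 j)))"
    using laplace_expansion_row[OF A, of 0] by (simp add: cofactor_def)
  ultimately have "det A = (\<Sum>j<2. A $$ (0, j) * ((- 1) ^ j * mat_delete A 0 j $$ (0, 0)))"
    by simp
  then show ?thesis
    by (simp add: mat_delete_def dims lessThan_Suc numeral_2_eq_2)
qed

lemma det_3x3:
  fixes A :: "'a::comm_ring_1 mat"
  assumes A: "A \<in> carrier_mat 3 3"
  shows "det A =
    A $$ (0, 0) * (A $$ (1, 1) * A $$ (2, 2) - A $$ (1, 2) * A $$ (2, 1)) -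
    A $$ (0, 1) * (A $$ (1, 0) * A $$ (2, 2) - A $$ (1, 2) * A $$ (2, 0)) +
    A $$ (0, 2) * (A $$ (1, 0) * A $$ (2, 1) - A $$ (1, 1) * A $$ (2, 0))"
proof -
  have dims: "dim_row A = 3" "dim_col A = 3"
    using A by auto
  have "mat_delete A 0 j \<in> carrier_mat 2 2" for j
    by (rule carrier_matI) (simp_all add: mat_delete_def dims)
  then have "det (mat_delete A 0 j) = mat_delete A 0 j $$ (0, 0) * mat_delete A 0 j $$ (1, 1)
      - mat_delete A 0 j $$ (0, 1) * mat_delete A 0 j $$ (1, 0)" for j
    by (rule det_2x2)
  moreover have "det A = (\<Sum>j<3. A $$ (0, j) * ((- 1) ^ j * det (mat_delete A 0 j)))"
    using laplace_expansion_row[OF A, of 0] by (simp add: cofactor_def)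
  ultimately have "det A = (\<Sum>j<3. A $$ (0, j) * ((- 1) ^ j *
      (mat_delete A 0 j $$ (0, 0) * mat_delete A 0 j $$ (1, 1)
      - mat_delete A 0 j $$ (0, 1) * mat_delete A 0 j $$ (1, 0))))"
    by simp
  then show ?thesis
    by (simp add: mat_delete_def dims lessThan_Suc numeral_3_eq_3 numeral_2_eq_2 algebra_simps)
qed

section \<open>The extension by a cube root of a non-cube\<close>

locale pure_cubic =
  fixes d :: "'a::field_char_0" and \<theta> :: "'a alg_closure"
  assumes cube: "\<theta> ^ 3 = to_ac d" and not_cube: "\<nexists>c. c ^ 3 = d"
begin

definition elem :: "'a \<Rightarrow> 'a \<Rightarrow> 'a \<Rightarrow> 'a alg_closure" where
  "elem x y z = to_ac x + to_ac y * \<theta> + to_ac z * \<theta>\<^sup>2"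

lemma theta_not_base: "\<theta> \<noteq> to_ac c"
  using cube not_cube by (metis to_ac_power to_ac_eq_iff)

lemma elem_add: "elem x y z + elem x' y' z' = elem (x + x') (y + y') (z + z')"
  by (simp add: elem_def algebra_simps)

lemma elem_mult:
  "elem x y z * elem x' y' z' =
     elem (x * x' + d * (y * z' + z * y')) (x * y' + y * x' + d * (z * z')) (x * z' + y * y' + z * x')"
  unfolding elem_def to_ac_add to_ac_mult cube[symmetric]
  by (simp add: power2_eq_square power3_eq_cube algebra_simps)

text \<open>A linear relation would put \<open>\<theta>\<close> into the base field. A relation
  \<open>\<theta>^2 = p \<theta> + q\<close>, multiplied by \<open>\<theta>\<close>, gives
  \<open>d = p q + (p^2 + q) \<theta>\<close>; hence \<open>q = - p^2\<close> and
  \<open>d = (- p)^3\<close>, a cube.\<close>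

lemma elem_eq_0_iff: "elem x y z = 0 \<longleftrightarrow> x = 0 \<and> y = 0 \<and> z = 0"
proof
  assume *: "elem x y z = 0"
  have linear: "v = 0" if "to_ac u + to_ac v * \<theta> = 0" for u v
  proof (rule ccontr)
    assume "v \<noteq> 0"
    then have "\<theta> = to_ac (- u / v)"
      using that by (simp add: field_simps eq_neg_iff_add_eq_0)
    then show False using theta_not_base by blast
  qed
  have "z = 0"
  proof (rule ccontr)
    assume z: "z \<noteq> 0"
    define p q where "p = - y / z" and "q = - x / z"
    have "to_ac z * (\<theta>\<^sup>2 - (to_ac p * \<theta> + to_ac q)) = 0"
      using * z by (simp add: elem_def p_def q_def field_simps)
    then have \<theta>2: "\<theta>\<^sup>2 = to_ac p * \<theta> + to_ac q"
      using z by simp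
    have "to_ac d = \<theta> * \<theta>\<^sup>2"
      by (simp add: cube power2_eq_square power3_eq_cube flip: cube)
    also have "\<dots> = \<theta> * (to_ac p * \<theta> + to_ac q)"
      by (simp only: \<theta>2)
    also have "\<dots> = to_ac p * \<theta>\<^sup>2 + to_ac q * \<theta>"
      by (simp add: algebra_simps power2_eq_square)
    also have "\<dots> = to_ac (p * q) + to_ac (p\<^sup>2 + q) * \<theta>"
      unfolding \<theta>2 by (simp add: algebra_simps power2_eq_square)
    finally have rel: "to_ac (p * q - d) + to_ac (p\<^sup>2 + q) * \<theta> = 0"
      by simp
    have quad: "p\<^sup>2 + q = 0"
      using linear[OF rel] .
    with rel have "to_ac (p * q - d) = 0"
      by (simp only: to_ac_0 mult_zero_left add_0_right)
    then have "p * q = d"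
      by (simp del: to_ac_diff to_ac_mult)
    moreover have "q = - p\<^sup>2"
      using quad by (simp add: eq_neg_iff_add_eq_0 add.commute)
    ultimately have "(- p) ^ 3 = d"
      by (simp add: power2_eq_square power3_eq_cube mult.assoc)
    with not_cube show False by blast
  qed
  with * linear[of x y] show "x = 0 \<and> y = 0 \<and> z = 0"
    by (auto simp: elem_def)
qed (simp add: elem_def)

text \<open>The second factor is the product of the two other conjugates, obtained from
  \<open>\<theta>\<close> by primitive cube roots of unity.\<close>

lemma elem_mult_adjugate:
  "elem x y z * elem (x\<^sup>2 - d * y * z) (d * z\<^sup>2 - x * y) (y\<^sup>2 - x * z) = to_ac (cbrt_form d x y z)"
proof -
  have "x * (x\<^sup>2 - d * y * z) + d * (y * (y\<^sup>2 - x * z) + z * (d * z\<^sup>2 - x * y)) = cbrt_form d x y z"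
    "x * (d * z\<^sup>2 - x * y) + y * (x\<^sup>2 - d * y * z) + d * (z * (y\<^sup>2 - x * z)) = 0"
    "x * (y\<^sup>2 - x * z) + y * (d * z\<^sup>2 - x * y) + z * (x\<^sup>2 - d * y * z) = 0"
    by (simp_all add: cbrt_form_def power2_eq_square power3_eq_cube algebra_simps)
  then show ?thesis
    unfolding elem_mult by (simp add: elem_def)
qed

text \<open>A vanishing norm makes the element or its adjugate zero, since the closure has no zero
  divisors.\<close>

lemma cbrt_form_eq_0_iff: "cbrt_form d x y z = 0 \<longleftrightarrow> x = 0 \<and> y = 0 \<and> z = 0"
proof
  assume "cbrt_form d x y z = 0"
  then have "elem x y z = 0 \<or> elem (x\<^sup>2 - d * y * z) (d * z\<^sup>2 - x * y) (y\<^sup>2 - x * z) = 0"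
    using elem_mult_adjugate[of x y z] by auto
  then show "x = 0 \<and> y = 0 \<and> z = 0"
  proof
    assume "elem (x\<^sup>2 - d * y * z) (d * z\<^sup>2 - x * y) (y\<^sup>2 - x * z) = 0"
    then have eqs: "x\<^sup>2 = d * y * z" "d * z\<^sup>2 = x * y" "y\<^sup>2 = x * z"
      by (simp_all add: elem_eq_0_iff)
    show ?thesis
    proof (cases "z = 0")
      case False
      \<comment> \<open>Both sides equal \<open>x y z\<close>.\<close>
      have "y ^ 3 = d * z ^ 3"
        using eqs(2,3) by (simp add: power2_eq_square power3_eq_cube mult_ac)
      then have "(y / z) ^ 3 = d"
        using False by (simp add: power_divide)
      with not_cube show ?thesis by blast
    qed (use eqs in simp)
  qed (simp add: elem_eq_0_iff)
qed (simp add: cbrt_form_def)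

text \<open>The inverse is the adjugate divided by the norm.\<close>

lemma inverse_elem: "\<exists>x' y' z'. inverse (elem x y z) = elem x' y' z'"
proof (cases "cbrt_form d x y z = 0")
  case True
  \<comment> \<open>Here the element is 0, and \<open>inverse 0 = 0\<close>.\<close>
  then have "inverse (elem x y z) = elem 0 0 0"
    by (simp add: cbrt_form_eq_0_iff elem_def)
  then show ?thesis by blast
next
  case False
  let ?N = "cbrt_form d x y z"
  have "elem x y z * (elem (x\<^sup>2 - d * y * z) (d * z\<^sup>2 - x * y) (y\<^sup>2 - x * z) * elem (inverse ?N) 0 0) = 1"
    using False by (simp only: elem_mult_adjugate flip: mult.assoc) (simp add: elem_def)
  then show ?thesis
    unfolding elem_mult[of "x\<^sup>2 - d * y * z"] using inverse_unique by blast
qed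

text \<open>By \<open>inverse_elem\<close> the polynomials in \<open>\<theta>\<close> of degree at
  most 2 already form a field.\<close>

lemma adjoin_eq: "adjoin \<theta> = {elem x y z | x y z. True}"
proof
  let ?S = "{elem x y z | x y z. True}"
  show "adjoin \<theta> \<subseteq> ?S"
  proof (rule adjoin_subset)
    have "\<theta> = elem 0 1 0" "to_ac c = elem c 0 0" for c
      by (simp_all add: elem_def)
    then show "\<theta> \<in> ?S" "range to_ac \<subseteq> ?S"
      by blast+
    show "inverse u \<in> ?S" if "u \<in> ?S" for u
      using that inverse_elem by auto
    show "u + v \<in> ?S" "u * v \<in> ?S" if "u \<in> ?S" "v \<in> ?S" for u v
      using that elem_add elem_mult by auto blast+
  qed
next
  show "{elem x y z | x y z. True} \<subseteq> adjoin \<theta>"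
    unfolding elem_def power2_eq_square by (auto intro!: adjoin_closed)
qed

lemma distinct_powers: "distinct [1, \<theta>, \<theta>\<^sup>2]"
  \<comment> \<open>The three triples encode the pairwise differences of the powers.\<close>
  using elem_eq_0_iff[of 1 "- 1" 0] elem_eq_0_iff[of 1 0 "- 1"] elem_eq_0_iff[of 0 1 "- 1"]
  by (auto simp: elem_def)

lemma is_basis_of_powers: "is_basis_of (adjoin \<theta>) [1, \<theta>, \<theta>\<^sup>2]"
proof -
  have "ac.independent {1, \<theta>, \<theta>\<^sup>2}"
  proof (rule ac.independent_if_scalars_zero)
    fix f v
    assume "(\<Sum>v\<in>{1, \<theta>, \<theta>\<^sup>2}. to_ac (f v) * v) = 0" "v \<in> {1, \<theta>, \<theta>\<^sup>2}"
    moreover from this have "elem (f 1) (f \<theta>) (f (\<theta>\<^sup>2)) = 0"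
      using distinct_powers by (simp add: elem_def add.assoc)
    ultimately show "f v = 0"
      by (auto simp: elem_eq_0_iff)
  qed simp
  moreover have "ac.span {1, \<theta>, \<theta>\<^sup>2} = adjoin \<theta>"
  proof (rule ac.span_unique)
    show "{1, \<theta>, \<theta>\<^sup>2} \<subseteq> adjoin \<theta>"
      using to_ac_in_adjoin[of 1 \<theta>] by (auto simp: power2_eq_square intro!: adjoin_closed)
    show "ac.subspace (adjoin \<theta>)"
      using to_ac_in_adjoin[of 0 \<theta>] by (intro ac.subspaceI) (auto intro!: adjoin_closed)
  next
    fix T assume T: "{1, \<theta>, \<theta>\<^sup>2} \<subseteq> T" "ac.subspace T"
    then have "to_ac x * 1 + to_ac y * \<theta> + to_ac z * \<theta>\<^sup>2 \<in> T" for x y z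
      using ac.subspace_scale[OF T(2)] by (intro ac.subspace_add[OF T(2)]) blast+
    then show "adjoin \<theta> \<subseteq> T"
      unfolding adjoin_eq elem_def mult_1_right by blast
  qed
  ultimately show ?thesis
    using distinct_powers by (simp add: is_basis_of_def)
qed

lemma representation_elem:
  defines "rep \<equiv> ac.representation {1, \<theta>, \<theta>\<^sup>2}"
  shows "rep (elem x y z) 1 = x" "rep (elem x y z) \<theta> = y" "rep (elem x y z) (\<theta>\<^sup>2) = z"
proof -
  have indep: "ac.independent {1, \<theta>, \<theta>\<^sup>2}"
    using is_basis_of_powers by (simp add: is_basis_of_def)
  have "rep (elem x y z) = (\<lambda>b. x * (if b = 1 then 1 else 0) + y * (if b = \<theta> then 1 else 0)
      + z * (if b = \<theta>\<^sup>2 then 1 else 0))"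
  proof -
    have "elem x y z = to_ac x * 1 + to_ac y * \<theta> + to_ac z * \<theta>\<^sup>2"
      by (simp add: elem_def)
    moreover have "to_ac k * v \<in> ac.span {1, \<theta>, \<theta>\<^sup>2}"
      "rep (to_ac k * v) = (\<lambda>b. k * (if b = v then 1 else 0))"
      if "v \<in> {1, \<theta>, \<theta>\<^sup>2}" for k v
      using that ac.span_base[OF that] unfolding rep_def
      by (auto simp: ac.span_scale ac.representation_scale[OF indep] ac.representation_basis[OF indep])
    ultimately show ?thesis
      unfolding rep_def by (simp only: ac.representation_add[OF indep] ac.span_add insertI1 insertI2)
  qed
  then show "rep (elem x y z) 1 = x" "rep (elem x y z) \<theta> = y" "rep (elem x y z) (\<theta>\<^sup>2) = z"
    using distinct_powers by auto
qed

text \<open>The columns of the matrix are the coordinates of the element times 1,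
  \<open>\<theta>\<close> and \<open>\<theta>^2\<close>, shifted cyclically with a factor
  \<open>d\<close> by \<open>\<theta>^3 = d\<close>.\<close>

lemma field_norm_elem: "field_norm (adjoin \<theta>) (elem x y z) = cbrt_form d x y z"
proof -
  have cols: "elem x y z * \<theta> = elem (d * z) x y" "elem x y z * \<theta>\<^sup>2 = elem (d * y) (d * z) x"
    using elem_mult[of x y z 0 1 0] elem_mult[of x y z 0 0 1] by (simp_all add: elem_def)
  have closed: "elem x y z * v \<in> adjoin \<theta>" if "v \<in> adjoin \<theta>" for v
    using that elem_mult unfolding adjoin_eq by blast
  let ?M = "mult_matrix [1, \<theta>, \<theta>\<^sup>2] (elem x y z)"
  have dim: "?M \<in> carrier_mat 3 3"
    unfolding mult_matrix_def by (rule carrier_matI) simp_all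
  have "det ?M = x * (x * x - d * z * y) - d * z * (y * x - d * z * z) + d * y * (y * y - x * z)"
    unfolding det_3x3[OF dim] by (simp add: mult_matrix_def cols representation_elem)
  also have "\<dots> = cbrt_form d x y z"
    by (simp add: cbrt_form_def power2_eq_square power3_eq_cube algebra_simps)
  finally have "det ?M = cbrt_form d x y z" .
  then show ?thesis
    using field_norm_eq_det[OF is_basis_of_powers closed] by simp
qed

end

section \<open>From field norms to the cubic form, and the equivalences\<close>

text \<open>Ensures that the choice in \<open>cbrt_ac\<close> for a non-cube does pick a cube
  root.\<close>

lemma alg_closure_cbrt_exists: "\<exists>\<theta>. \<theta> ^ 3 = (x :: 'a::field alg_closure)"
proof -
  have "\<exists>\<theta>. poly [:- x, 0, 0, 1:] \<theta> = 0"
    by (intro alg_closed_imp_poly_has_root) simp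
  then show ?thesis by (simp add: power3_eq_cube mult.assoc)
qed

text \<open>For a cube the extension is trivial and every number is its own norm. The first disjunct
  matters at \<open>d = 0\<close>, where the form shrinks to \<open>x^3\<close>.\<close>

lemma is_norm_for_adjoin_cbrt_iff:
  fixes c d :: "'a::field_char_0"
  shows "is_norm_for c (adjoin_cbrt d) \<longleftrightarrow> (\<exists>e. e ^ 3 = d) \<or> is_cbrt_norm c d"
proof (cases "\<exists>e. e ^ 3 = d")
  case True
  then have "adjoin_cbrt d = range to_ac"
    by (simp add: adjoin_cbrt_def cbrt_ac_def adjoin_to_ac)
  then show ?thesis
    using True field_norm_base[of c] unfolding is_norm_for_def by (metis rangeI)
next
  case False
  have "(SOME \<theta>. \<theta> ^ 3 = to_ac d) ^ 3 = to_ac d"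
    using alg_closure_cbrt_exists by (rule someI_ex)
  then interpret pure_cubic d "cbrt_ac d"
    using False by unfold_locales (auto simp: cbrt_ac_def)
  have "(\<exists>\<xi>\<in>adjoin (cbrt_ac d). P \<xi>) \<longleftrightarrow> (\<exists>x y z. P (elem x y z))" for P
    unfolding adjoin_eq by auto
  then show ?thesis
    using False by (simp add: is_norm_for_def adjoin_cbrt_def field_norm_elem is_cbrt_norm_def)
qed

theorem theorem3p1:
  fixes a b :: "'a::field_char_0"
  assumes "number_field TYPE('a)"
  shows "(is_norm_for a (adjoin_cbrt b) \<longleftrightarrow> is_norm_for b (adjoin_cbrt a)) \<and>
         (is_norm_for a (adjoin_cbrt b) \<longleftrightarrow> is_norm_for (a\<^sup>2 * b) (adjoin_cbrt (a + b))) \<and>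
         (is_norm_for a (adjoin_cbrt b) \<longleftrightarrow> is_norm_for (a\<^sup>2 * b) (adjoin_cbrt (a - b))) \<and>
         (is_norm_for a (adjoin_cbrt b) \<longleftrightarrow> V a b \<noteq> {})"
proof -
  \<comment> \<open>These make all norm conditions true as soon as \<open>a\<close> or
    \<open>b\<close> vanishes.\<close>
  have norm_0: "is_norm_for 0 (adjoin_cbrt d)" "is_norm_for d (adjoin_cbrt 0)" for d :: 'a
    using is_cbrt_norm_cube[of 0 d] by (auto simp: is_norm_for_adjoin_cbrt_iff intro: exI[of _ 0])
  have norm_iff: "is_norm_for c (adjoin_cbrt d) \<longleftrightarrow> is_cbrt_norm c d" if "d \<noteq> 0" for c d :: 'a
    using that is_cbrt_norm_of_cube is_norm_for_adjoin_cbrt_iff by blast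
  consider "a = 0" | "b = 0" | "a \<noteq> 0" "b \<noteq> 0" by blast
  then show ?thesis
  proof cases
    case 1
    then have "V a b \<noteq> {}"
      unfolding V_nonempty_iff by (intro has_surface_pointI[of 0 a 1 b 0 0]) auto
    with 1 show ?thesis by (simp add: norm_0)
  next
    case 2
    then have "V a b \<noteq> {}"
      unfolding V_nonempty_iff by (intro has_surface_pointI[of 0 a 0 b 1 0]) auto
    with 2 show ?thesis by (simp add: norm_0)
  next
    case 3
    \<comment> \<open>Stated for general \<open>c\<close> so as to serve both \<open>b\<close> and
      \<open>- b\<close>.\<close>
    have sum: "is_norm_for (a\<^sup>2 * c) (adjoin_cbrt (a + c)) \<longleftrightarrow> is_cbrt_norm a c" if "c \<noteq> 0" for c
    proof (cases "a + c = 0")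
      \<comment> \<open>The left side holds because adjoining a root of 0 changes nothing; the right
        side holds because \<open>a = - c\<close> and \<open>c\<close> represents both
        \<open>c\<close> and -1.\<close>
      case True
      then have "is_cbrt_norm a c"
        using is_cbrt_norm_self[of c] is_cbrt_norm_minus_iff[of c c] by (simp add: add_eq_0_iff2)
      with True show ?thesis by (simp add: norm_0)
    qed (use \<open>a \<noteq> 0\<close> that norm_iff is_cbrt_norm_add_iff in simp)
    have "is_norm_for (a\<^sup>2 * b) (adjoin_cbrt (a - b)) \<longleftrightarrow> is_norm_for (a\<^sup>2 * - b) (adjoin_cbrt (a + - b))"
      by (simp add: is_norm_for_adjoin_cbrt_iff is_cbrt_norm_minus_iff)
    \<comment> \<open>The sign sits in the second argument: swap, drop it as a cube, and swap
      back.\<close>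
    also have "\<dots> \<longleftrightarrow> is_cbrt_norm a b"
      using 3 sum[of "- b"] is_cbrt_norm_commute[of a "- b"] is_cbrt_norm_commute[of a b]
      by (simp add: is_cbrt_norm_minus_iff)
    finally have diff: "is_norm_for (a\<^sup>2 * b) (adjoin_cbrt (a - b)) \<longleftrightarrow> is_cbrt_norm a b" .
    show ?thesis
      unfolding diff sum[OF \<open>b \<noteq> 0\<close>] norm_iff[OF \<open>a \<noteq> 0\<close>] norm_iff[OF \<open>b \<noteq> 0\<close>]
        V_nonempty_iff is_cbrt_norm_iff_surface[OF 3, symmetric]
      using is_cbrt_norm_commute[OF 3] by blast
  qed
qed

end
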